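(* For every real $x>0$, $$\frac{\sinh x}{x}+\left[\frac{\tanh(x/2)}{x/2}\right]^2>2+\frac{23}{720}x^3\tanh x.$$ Moreover, the constant $\frac{23}{720}$ is the best possible.
   Context: "Best possible" means that the constant cannot be replaced by any larger real constant with the inequality still holding for all $x>0$. *)

theory Defs
  imports Complex_Main
begin

end

theory Submission
  imports Defs "HOL-Real_Asymp.Real_Asymp"
begin

text \<open>
  Multiplying the difference of the two sides by \<open>x\<^sup>2 cosh x (cosh x + 1)\<close> and using
  \<open>tanh\<^sup>2 (x/2) = (cosh x - 1) / (cosh x + 1)\<close> turns it into a combination of terms
  \<open>x\<^sup>j cosh (k x)\<close> and \<open>x\<^sup>j sinh (k x)\<close> with \<open>k \<le> 3\<close>. This is an even entire function whose
  Taylor coefficients vanish up to degree 7 and are positive in every even degree from 8 on,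
  because there \<open>3\<^sup>m\<close> beats \<open>m\<^sup>4 2\<^sup>m\<close>. The constant is the limit of the
  corresponding quotient at 0.
\<close>

section \<open>Power series of \<open>x ^ j * cosh (k * x)\<close> and
  \<open>x ^ j * sinh (k * x)\<close>\<close>

definition falling :: "nat \<Rightarrow> nat \<Rightarrow> real" where
  "falling m j = (\<Prod>i<j. real m - real i)"

lemma falling_eq_0: "m < j \<Longrightarrow> falling m j = 0"
  unfolding falling_def by (rule prod_zero) auto

lemma falling_Suc_Suc: "falling (Suc m) (Suc j) = real (Suc m) * falling m j"
  unfolding falling_def by (subst prod.lessThan_Suc_shift) simp

lemma falling_add_fact: "falling (n + j) j * fact n = fact (n + j)"
proof (induction j)
  case 0
  show ?case by (simp add: falling_def)
next
  case (Suc j)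
  then show ?case by (simp add: falling_Suc_Suc mult.assoc del: of_nat_Suc)
qed

lemma falling_simps:
  "falling m 0 = 1"
  "falling m (Suc j) = falling m j * (real m - real j)"
  by (simp_all add: falling_def)

text \<open>Multiplying the exponential series by \<open>x ^ j\<close> shifts its index by
  \<open>j\<close>. The quotient \<open>falling m j / fact m\<close> is
  \<open>1 / fact (m - j)\<close> for \<open>m \<ge> j\<close> and 0 below, so the truncated
  exponent \<open>m - j\<close> does no harm and series with different \<open>j\<close> add
  termwise.\<close>

lemma sums_power_mult_exp:
  fixes k x :: real
  shows "(\<lambda>m. falling m j * k ^ (m - j) / fact m * x ^ m) sums (x ^ j * exp (k * x))"
proof -
  have "(\<lambda>n. (k * x) ^ n /\<^sub>R fact n) sums exp (k * x)"
    by (rule exp_converges)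
  then have "(\<lambda>n. x ^ j * ((k * x) ^ n /\<^sub>R fact n)) sums (x ^ j * exp (k * x))"
    by (rule sums_mult)
  moreover have "x ^ j * ((k * x) ^ n /\<^sub>R fact n)
      = falling (n + j) j * k ^ (n + j - j) / fact (n + j) * x ^ (n + j)" for n
  proof -
    have "falling (n + j) j / fact (n + j) = 1 / fact n"
      using falling_add_fact[of n j] by (simp add: field_simps)
    then have "falling (n + j) j * k ^ n / fact (n + j) = k ^ n / fact n"
      by (metis mult.commute mult.right_neutral times_divide_eq_right)
    then have "falling (n + j) j * k ^ (n + j - j) / fact (n + j) * x ^ (n + j)
        = k ^ n / fact n * x ^ (n + j)"
      by simp
    also have "\<dots> = x ^ j * ((k * x) ^ n /\<^sub>R fact n)"
      by (simp add: power_mult_distrib power_add divide_inverse mult_ac)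
    finally show ?thesis by simp
  qed
  ultimately have "(\<lambda>n. falling (n + j) j * k ^ (n + j - j) / fact (n + j) * x ^ (n + j))
      sums (x ^ j * exp (k * x))"
    by simp
  then show ?thesis
    by (subst (asm) sums_iff_shift) (simp add: falling_eq_0)
qed

lemma sums_power_mult_cosh:
  fixes k x :: real
  shows "(\<lambda>m. falling m j * ((k ^ (m - j) + (- k) ^ (m - j)) / 2) / fact m * x ^ m)
    sums (x ^ j * cosh (k * x))"
  using sums_divide[OF sums_add[OF sums_power_mult_exp[of j k x] sums_power_mult_exp[of j "-k" x]], of 2]
  by (simp add: cosh_field_def algebra_simps add_divide_distrib)

lemma sums_power_mult_sinh:
  fixes k x :: real
  shows "(\<lambda>m. falling m j * ((k ^ (m - j) - (- k) ^ (m - j)) / 2) / fact m * x ^ m)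
    sums (x ^ j * sinh (k * x))"
  using sums_divide[OF sums_diff[OF sums_power_mult_exp[of j k x] sums_power_mult_exp[of j "-k" x]], of 2]
  by (simp add: sinh_field_def algebra_simps diff_divide_distrib)

section \<open>Positivity of the Taylor coefficients\<close>

text \<open>
  With \<open>m = p + 8\<close>, this is the leading part of the coefficient inequality after division by \<open>m\<close>;
  the lower-order terms are absorbed by \<open>2\<^sup>p \<ge> 1\<close>, which turns \<open>64 \<cdot> 2\<^sup>p + 2\<close> into \<open>66 \<cdot> 2\<^sup>p\<close> and
  \<open>4 \<cdot> 2\<^sup>p + 1\<close> into \<open>5 \<cdot> 2\<^sup>p\<close>.
\<close>
lemma pow3_dominates:
  fixes p :: nat
  defines "q \<equiv> \<lambda>p::real. 33 / 2 * (p + 7) - 16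
      + 23 / 576 * ((p + 7) * (p + 6) * (p + 5) * (p + 4))"
  shows "4 * 2 ^ p * q (real p) < 3 ^ (p + 7) / 4"
proof (induction p)
  case 0
  show ?case by (simp add: q_def)
next
  case (Suc p)
  \<comment> \<open>From \<open>p\<close> to \<open>p + 1\<close> the right side triples and
    \<open>2 ^ p\<close> doubles, so \<open>q\<close> may grow by the factor 3/2. The difference
    below has only positive coefficients.\<close>
  have "q (real p + 1) \<le> 3 / 2 * q (real p)"
  proof -
    have "3 / 2 * q (real p) - q (real p + 1) =
        23 / 1152 * (real p ^ 4 + 14 * real p ^ 3 + 35 * real p ^ 2)
        + (33 / 4 - 23 * 218 / 1152) * real p + (133 / 4 - 23 * 840 / 1152)"
      unfolding q_def by (simp add: field_simps power2_eq_square power3_eq_cube power4_eq_xxxx)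
    also have "\<dots> \<ge> 0" by (intro add_nonneg_nonneg mult_nonneg_nonneg) auto
    finally show ?thesis by simp
  qed
  then have "4 * 2 ^ Suc p * q (real (Suc p)) \<le> 4 * 2 ^ Suc p * (3 / 2 * q (real p))"
    by (intro mult_left_mono) (auto simp: add.commute)
  also have "\<dots> = 3 * (4 * 2 ^ p * q (real p))" by simp
  also have "\<dots> < 3 * (3 ^ (p + 7) / 4)"
    by (intro mult_strict_left_mono Suc.IH) simp
  also have "\<dots> = 3 ^ (Suc p + 7) / 4" by (simp add: power_add)
  finally show ?case .
qed

text \<open>For even \<open>p\<close>, right minus left is \<open>fact (p + 8)\<close> times the
  coefficient of degree \<open>p + 8\<close> in the series of \<open>cleared\<close>. Dividing by
  \<open>m\<close> leads to \<open>pow3_dominates\<close>.\<close>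

lemma coefficient_pos:
  fixes p :: nat
  defines "m \<equiv> real p + 8"
  shows "m * (m - 1) * (2 ^ (p + 6) + 2)
      + 23 / 720 * (m * (m - 1) * (m - 2) * (m - 3) * (m - 4)) * (2 ^ (p + 2) + 1)
    < m * (3 ^ (p + 7) + 1) / 4 + m * 2 ^ (p + 6) + 2 * 2 ^ (p + 8) - 4"
proof -
  define u :: real where "u = 2 ^ p"
  define r where "r = 23 / 720 * ((m - 1) * (m - 2) * (m - 3) * (m - 4))"
  have u: "u \<ge> 1" by (simp add: u_def)
  have m: "m \<ge> 8" by (simp add: m_def)
  have r: "r \<ge> 0" unfolding r_def using m by simp
  \<comment> \<open>The constant \<open>23 / 576\<close> in \<open>pow3_dominates\<close> is 5/4
    times \<open>23 / 720\<close>.\<close>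
  have "4 * u * (33 / 2 * (m - 1) - 16 + 5 / 4 * r) < 3 ^ (p + 7) / 4"
    using pow3_dominates[of p] by (simp add: u_def r_def m_def algebra_simps)
  moreover have "4 * u * (33 / 2 * (m - 1) - 16 + 5 / 4 * r)
      = (m - 1) * (66 * u) - 64 * u + r * (5 * u)"
    by (simp add: field_simps)
  moreover have "(m - 1) * (64 * u + 2) \<le> (m - 1) * (66 * u)"
    using m u by (intro mult_left_mono) auto
  moreover have "r * (4 * u + 1) \<le> r * (5 * u)"
    using r u by (intro mult_left_mono) auto
  ultimately have "(m - 1) * (64 * u + 2) + r * (4 * u + 1) < (3 ^ (p + 7) + 1) / 4 + 64 * u"
    by argo
  then have "m * ((m - 1) * (64 * u + 2) + r * (4 * u + 1))
      < m * ((3 ^ (p + 7) + 1) / 4 + 64 * u)"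
    using m by (intro mult_strict_left_mono) auto
  also have "\<dots> \<le> m * ((3 ^ (p + 7) + 1) / 4 + 64 * u) + (512 * u - 4)"
    using u by simp
  also have "\<dots> = m * (3 ^ (p + 7) + 1) / 4 + m * 2 ^ (p + 6) + 2 * 2 ^ (p + 8) - 4"
    by (simp add: u_def power_add algebra_simps)
  also have "m * ((m - 1) * (64 * u + 2) + r * (4 * u + 1)) = m * (m - 1) * (2 ^ (p + 6) + 2)
      + 23 / 720 * (m * (m - 1) * (m - 2) * (m - 3) * (m - 4)) * (2 ^ (p + 2) + 1)"
    by (simp add: u_def r_def power_add algebra_simps)
  finally show ?thesis .
qed

text \<open>The redundant factors keep every summand in the form \<open>a * (x ^ j * cosh (k * x))\<close> or
  \<open>a * (x ^ j * sinh (k * x))\<close>, so that the power series can be added termwise.\<close>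
definition cleared :: "real \<Rightarrow> real" where
  "cleared x = 1 / 4 * (x ^ 1 * sinh (3 * x)) + 1 / 4 * (x ^ 1 * sinh (1 * x))
    + 1 / 2 * (x ^ 1 * sinh (2 * x)) + 2 * (x ^ 0 * cosh (2 * x)) + 2 * (x ^ 0 * cosh (0 * x))
    - 4 * (x ^ 0 * cosh (1 * x)) - 1 * (x ^ 2 * cosh (2 * x)) - 1 * (x ^ 2 * cosh (0 * x))
    - 2 * (x ^ 2 * cosh (1 * x)) - 23 / 1440 * (x ^ 5 * sinh (2 * x))
    - 23 / 720 * (x ^ 5 * sinh (1 * x))"

lemma cleared_pos:
  assumes "x > 0"
  shows "cleared x > 0"
proof -
  define a where "a = (\<lambda>j k m. falling m j * ((k ^ (m - j) + (- k) ^ (m - j)) / 2) / fact m * x ^ m)"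
  define b where "b = (\<lambda>j k m. falling m j * ((k ^ (m - j) - (- k) ^ (m - j)) / 2) / fact m * x ^ m)"
  define f where "f = (\<lambda>m. 1 / 4 * b 1 3 m + 1 / 4 * b 1 1 m + 1 / 2 * b 1 2 m
     + 2 * a 0 2 m + 2 * a 0 0 m - 4 * a 0 1 m - 1 * a 2 2 m - 1 * a 2 0 m - 2 * a 2 1 m
     - 23 / 1440 * b 5 2 m - 23 / 720 * b 5 1 m)"
  have f: "f sums cleared x"
    unfolding f_def cleared_def a_def b_def
    by (intro sums_add sums_diff sums_mult sums_power_mult_cosh sums_power_mult_sinh)
  \<comment> \<open>Only even \<open>j\<close> occur with cosh and odd \<open>j\<close> with sinh,
    so each summand is an even function.\<close>
  have f_odd: "f m = 0" if "odd m" for m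
  proof -
    have "b j k m = 0" if "odd j" for j k
      using that \<open>odd m\<close> by (cases "m < j") (auto simp: b_def falling_eq_0)
    moreover have "a j k m = 0" if "even j" for j k
      using that \<open>odd m\<close> by (cases "m < j") (auto simp: a_def falling_eq_0)
    ultimately show ?thesis by (simp add: f_def)
  qed
  have f_even: "f (p + 8) > 0" if "even p" for p
  proof -
    define m where "m = real p + 8"
    define d where "d = x ^ (p + 8) / fact (p + 8)"
    have d: "d > 0" using assms by (simp add: d_def)
    have F: "falling (p + 8) 0 = 1" "falling (p + 8) 1 = m" "falling (p + 8) 2 = m * (m - 1)"
      "falling (p + 8) 5 = m * (m - 1) * (m - 2) * (m - 3) * (m - 4)"
      by (simp_all add: falling_simps m_def eval_nat_numeral)
    have b: "b j k (p + 8) = falling (p + 8) j * k ^ (p + 8 - j) * d" if "odd j" "j < 8" for j k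
      using that \<open>even p\<close> by (simp add: b_def d_def)
    have a: "a j k (p + 8) = falling (p + 8) j * k ^ (p + 8 - j) * d" if "even j" "j < 8" for j k
      using that \<open>even p\<close> by (simp add: a_def d_def)
    have "f (p + 8) = d * (m * (3 ^ (p + 7) + 1) / 4 + m * 2 ^ (p + 6) + 2 * 2 ^ (p + 8) - 4
      - (m * (m - 1) * (2 ^ (p + 6) + 2)
      + 23 / 720 * (m * (m - 1) * (m - 2) * (m - 3) * (m - 4)) * (2 ^ (p + 2) + 1)))"
      unfolding f_def by (simp add: a b F F[simplified]) (simp add: field_simps power_add)
    also have "\<dots> > 0" using d coefficient_pos[of p] by (simp add: m_def)
    finally show ?thesis .
  qed
  have f_small: "f m = 0" if "even m" "m < 8" for m
  proof -
    \<comment> \<open>The four coefficients are evaluated directly; the one of degree 6 vanishes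
      precisely because of the constant 23/720.\<close>
    have "m \<in> {0, 2, 4, 6}" using that by (auto elim!: evenE)
    then show ?thesis
      by (auto simp: f_def a_def b_def falling_simps eval_nat_numeral fact_reduce field_simps)
  qed
  have nonneg: "f m \<ge> 0" for m
  proof (cases "odd m \<or> m < 8")
    case True
    then have "f m = 0" using f_odd f_small by blast
    then show ?thesis by simp
  next
    case False
    then show ?thesis using f_even[of "m - 8"] by simp
  qed
  have "0 < suminf f"
    using f_even[of 0] nonneg sums_summable[OF f] by (intro suminf_pos2[of _ 8]) auto
  then show ?thesis using sums_unique[OF f] by simp
qed

section \<open>Reduction of the inequality to \<open>cleared\<close>\<close>

lemma tanh_half_squared:
  fixes x :: real
  shows "(tanh (x / 2))\<^sup>2 = (cosh x - 1) / (cosh x + 1)"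
proof -
  have "cosh x = 2 * (cosh (x / 2))\<^sup>2 - 1" "cosh x = 2 * (sinh (x / 2))\<^sup>2 + 1"
    using cosh_double_cosh[of "x / 2"] by (simp_all add: sinh_square_eq)
  then have "cosh x + 1 = 2 * (cosh (x / 2))\<^sup>2" "cosh x - 1 = 2 * (sinh (x / 2))\<^sup>2"
    by linarith+
  then show ?thesis by (simp add: tanh_def power_divide)
qed

lemma cleared_eq:
  assumes "x \<noteq> 0"
  shows "cleared x = x\<^sup>2 * (cosh x * (cosh x + 1)) *
    (sinh x / x + (tanh (x / 2) / (x / 2))\<^sup>2 - (2 + 23 / 720 * x ^ 3 * tanh x))"
proof -
  define s c where "s = sinh x" and "c = cosh x"
  have c: "c > 0" by (simp add: c_def)
  have d: "sinh (2 * x) = 2 * s * c" "cosh (2 * x) = 2 * c\<^sup>2 - 1"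
    by (simp_all add: s_def c_def sinh_double cosh_double_cosh)
  have "sinh (3 * x) = sinh (2 * x + x)" by simp
  also have "\<dots> = 2 * s * c * c + (2 * c\<^sup>2 - 1) * s"
    by (simp only: sinh_add d) (simp add: s_def c_def)
  finally have t: "sinh (3 * x) = 4 * s * c\<^sup>2 - s"
    by (simp add: power2_eq_square algebra_simps)
  \<comment> \<open>With the multiple angles expanded, the claim becomes a rational identity in
    \<open>x\<close>, \<open>s\<close> and \<open>c\<close>.\<close>
  have "cleared x = x * s * c * (c + 1) + 4 * c * (c - 1) - 2 * x\<^sup>2 * (c * (c + 1))
      - 23 / 720 * x ^ 5 * s * (c + 1)"
    unfolding cleared_def d t
    by (simp add: s_def[symmetric] c_def[symmetric] power2_eq_square field_simps)
  also have "\<dots> = x\<^sup>2 * (c * (c + 1)) * (s / x + 4 * ((c - 1) / (c + 1)) / x\<^sup>2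
      - (2 + 23 / 720 * x ^ 3 * (s / c)))"
  proof -
    have "c + 1 \<noteq> 0" using c by simp
    then show ?thesis using assms c
      by (simp add: divide_simps) (simp add: algebra_simps eval_nat_numeral)
  qed
  finally show ?thesis
    by (simp add: power_divide tanh_half_squared tanh_def[of x] s_def c_def mult_ac)
qed

section \<open>Sharpness of the constant\<close>

text \<open>\<open>A\<close> and \<open>B\<close> are the scaled remainders after the quadratic
  Taylor polynomials. The \<open>x ^ 4\<close> coefficient of the numerator is 1/120 + 1/144 + 2/120
  = 23/720, where 1/144 is the square of 1/12.\<close>

lemma tendsto_best_constant:
  "((\<lambda>x::real. (sinh x / x + (tanh (x / 2) / (x / 2))\<^sup>2 - 2) / (x ^ 3 * tanh x))
    \<longlongrightarrow> 23 / 720) (at_right 0)"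
proof -
  define A where "A = (\<lambda>x::real. (sinh x / x - 1 - x\<^sup>2 / 6) / x ^ 4)"
  define B where "B = (\<lambda>x::real. (tanh (x / 2) / (x / 2) - 1 + x\<^sup>2 / 12) / x ^ 4)"
  have A: "(A \<longlongrightarrow> 1 / 120) (at_right 0)" unfolding A_def by real_asymp
  have B: "(B \<longlongrightarrow> 1 / 120) (at_right 0)" unfolding B_def by real_asymp
  have T: "((\<lambda>x::real. tanh x / x) \<longlongrightarrow> 1) (at_right 0)" by real_asymp
  have "((\<lambda>x. (A x + 1 / 144 + 2 * B x - x\<^sup>2 * B x / 6 + x ^ 4 * (B x)\<^sup>2) / (tanh x / x))
      \<longlongrightarrow> (1 / 120 + 1 / 144 + 2 * (1 / 120) - 0\<^sup>2 * (1 / 120) / 6 + 0 ^ 4 * (1 / 120)\<^sup>2) / 1)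
      (at_right 0)"
    by (intro tendsto_intros A B T) auto
  then have "((\<lambda>x. (A x + 1 / 144 + 2 * B x - x\<^sup>2 * B x / 6 + x ^ 4 * (B x)\<^sup>2) / (tanh x / x))
      \<longlongrightarrow> 23 / 720) (at_right 0)"
    by simp
  moreover have "eventually (\<lambda>x. (A x + 1 / 144 + 2 * B x - x\<^sup>2 * B x / 6 + x ^ 4 * (B x)\<^sup>2) / (tanh x / x)
      = (sinh x / x + (tanh (x / 2) / (x / 2))\<^sup>2 - 2) / (x ^ 3 * tanh x)) (at_right 0)"
    using eventually_at_right_less[of 0]
  proof eventually_elim
    case (elim x)
    have a: "sinh x / x = 1 + x\<^sup>2 / 6 + x ^ 4 * A x"
      using elim by (simp add: A_def)
    have b: "tanh (x / 2) / (x / 2) = 1 - x\<^sup>2 / 12 + x ^ 4 * B x"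
      using elim by (simp add: B_def)
    have "sinh x / x + (tanh (x / 2) / (x / 2))\<^sup>2 - 2
        = x ^ 4 * (A x + 1 / 144 + 2 * B x - x\<^sup>2 * B x / 6 + x ^ 4 * (B x)\<^sup>2)"
      unfolding a b by (simp add: algebra_simps eval_nat_numeral)
    moreover have "x ^ 3 * tanh x = x ^ 4 * (tanh x / x)"
      using elim by (simp add: eval_nat_numeral)
    ultimately show ?case using elim by simp
  qed
  ultimately show ?thesis by (rule Lim_transform_eventually)
qed

theorem theorem3p4:
  shows "(\<forall>x::real. x > 0 \<longrightarrow>
            sinh x / x + (tanh (x / 2) / (x / 2))\<^sup>2 > 2 + 23 / 720 * x ^ 3 * tanh x)
       \<and> (\<forall>c::real. c > 23 / 720 \<longrightarrow>
            \<not> (\<forall>x::real. x > 0 \<longrightarrow>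
                  sinh x / x + (tanh (x / 2) / (x / 2))\<^sup>2 > 2 + c * x ^ 3 * tanh x))"
proof (intro conjI allI impI notI)
  fix x :: real
  assume x: "x > 0"
  have "x\<^sup>2 * (cosh x * (cosh x + 1)) > 0"
    using x by (simp add: add_pos_pos)
  moreover have "0 < x\<^sup>2 * (cosh x * (cosh x + 1)) *
      (sinh x / x + (tanh (x / 2) / (x / 2))\<^sup>2 - (2 + 23 / 720 * x ^ 3 * tanh x))"
    using cleared_pos[OF x] cleared_eq[of x] x by simp
  ultimately have "0 < sinh x / x + (tanh (x / 2) / (x / 2))\<^sup>2 - (2 + 23 / 720 * x ^ 3 * tanh x)"
    by (rule zero_less_mult_pos[rotated])
  then show "2 + 23 / 720 * x ^ 3 * tanh x < sinh x / x + (tanh (x / 2) / (x / 2))\<^sup>2"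
    by linarith
next
  fix c :: real
  assume c: "c > 23 / 720"
    and less: "\<forall>x>0. 2 + c * x ^ 3 * tanh x < sinh x / x + (tanh (x / 2) / (x / 2))\<^sup>2"
  let ?g = "\<lambda>x::real. (sinh x / x + (tanh (x / 2) / (x / 2))\<^sup>2 - 2) / (x ^ 3 * tanh x)"
  have "(?g \<longlongrightarrow> 23 / 720) (at_right 0)"
    by (rule tendsto_best_constant)
  \<comment> \<open>A valid \<open>c\<close> bounds the quotient from below near 0, hence also its
    limit.\<close>
  moreover have "eventually (\<lambda>x. c \<le> ?g x) (at_right 0)"
    using eventually_at_right_less[of 0]
  proof eventually_elim
    case (elim x)
    then have "x ^ 3 * tanh x > 0" by simp
    moreover have "c * (x ^ 3 * tanh x) \<le> sinh x / x + (tanh (x / 2) / (x / 2))\<^sup>2 - 2"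
      using less[rule_format, OF elim] by (simp only: mult.assoc)
    ultimately show ?case by (simp only: pos_le_divide_eq)
  qed
  ultimately have "c \<le> 23 / 720"
    by (intro tendsto_lowerbound) auto
  with c show False by simp
qed

end
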